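(* Let $Z$ be a reflexive separable Banach space, let $\mathcal{D}$ and $\mathcal{D}_h$ ($h\in\mathbb{N}$) be subsets of $Z$, and let $\mathcal{E}$ be a weakly sequentially closed subset of $Z$. For $(y,z)\in Z\times Z$ let $$F_h(y,z)=I_{\mathcal{D}_h}(y)+I_{\mathcal{E}}(z)+\|y-z\|^2.$$ Suppose: (i) (Data convergence) $\mathcal{D}\times\mathcal{E}=K(\Delta)\text{-}\lim_{h\to\infty}(\mathcal{D}_h\times\mathcal{E})$. (ii) (Equi-transversality) There are constants $c>0$ and $b\ge0$ such that, for all $h$, all $y\in\mathcal{D}_h$ and all $z\in\mathcal{E}$, $\|y-z\|\ge c(\|y\|+\|z\|)-b$. Then: (a) If $(y_h,z_h)$ is a sequence in $Z\times Z$ with $F_h(y_h,z_h)\to0$, there exists $z\in\mathcal{D}\cap\mathcal{E}$ such that, up to subsequences, $(z,z)=\Delta\text{-}\lim_{h\to\infty}(y_h,z_h)$. (b) If $z\in\mathcal{D}\cap\mathcal{E}$, there exists a sequence $(y_h,z_h)$ in $Z\times Z$ such that $(z,z)=\Delta\text{-}\lim_{h\to\infty}(y_h,z_h)$ and $F_h(y_h,z_h)\to0$.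
   Context: $I_A$ is the indicator function of a set $A$: $0$ on $A$ and $\infty$ elsewhere. Data convergence of sequences: $(y,z)=\Delta\text{-}\lim_{h\to\infty}(y_h,z_h)$ in $Z\times Z$ means $y_h\rightharpoonup y$ weakly, $z_h\rightharpoonup z$ weakly, and $y_h-z_h\to y-z$ strongly in $Z$. Data topology $\Delta$ on $Z\times Z$: the coarsest topology for which all sets $(A\times A')\cap\{(z,z'):z-z'\in C\}$ are open, with $A,A'\subset Z$ weakly open and $C\subset Z$ strongly open. Kuratowski limit: for subsets $S,S_h$ of $Z\times Z$, $S=K(\Delta)\text{-}\lim_{h\to\infty}S_h$ means that the indicator functions $I_{S_h}$ $\Gamma$-converge to $I_S$ with respect to $\Delta$, i.e. for all $p\in Z\times Z$ $$I_S(p)=\sup_{U\in\mathcal{N}(p)}\liminf_{h\to\infty}\inf_{q\in U}I_{S_h}(q)=\sup_{U\in\mathcal{N}(p)}\limsup_{h\to\infty}\inf_{q\in U}I_{S_h}(q),$$ where $\mathcal{N}(p)$ is the family of all $\Delta$-open sets containing $p$. *)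

theory Defs
  imports "HOL-Analysis.Analysis"
begin

definition reflexive_space :: "'a::real_normed_vector itself \<Rightarrow> bool" where
  "reflexive_space _ \<longleftrightarrow>
     (\<forall>\<phi> :: ('a \<Rightarrow>\<^sub>L real) \<Rightarrow>\<^sub>L real. \<exists>x :: 'a. \<forall>f. blinfun_apply \<phi> f = blinfun_apply f x)"

definition weak_topology :: "'a::real_normed_vector topology" where
  "weak_topology =
     topology_generated_by {blinfun_apply f -` U | (f :: 'a \<Rightarrow>\<^sub>L real) U. open U}"

lemma topspace_weak_topology [simp]: "topspace weak_topology = UNIV"
proof -
  have "UNIV \<in> {blinfun_apply f -` U | (f :: 'a \<Rightarrow>\<^sub>L real) U. open U}"
    by (metis (mono_tags, lifting) mem_Collect_eq open_UNIV vimage_UNIV)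
  then show ?thesis
    unfolding weak_topology_def topology_generated_by_topspace by (intro equalityI subset_UNIV Union_upper)
qed

lemma limitin_weak_topology_iff:
  "limitin weak_topology x l F \<longleftrightarrow>
     (\<forall>f :: 'a::real_normed_vector \<Rightarrow>\<^sub>L real. ((\<lambda>n. blinfun_apply f (x n)) \<longlongrightarrow> blinfun_apply f l) F)"
proof (intro iffI allI)
  fix f :: "'a \<Rightarrow>\<^sub>L real"
  assume lim: "limitin weak_topology x l F"
  show "((\<lambda>n. blinfun_apply f (x n)) \<longlongrightarrow> blinfun_apply f l) F"
  proof (rule topological_tendstoI)
    fix U :: "real set"
    assume U: "open U" "blinfun_apply f l \<in> U"
    have "openin weak_topology (blinfun_apply f -` U)"
      unfolding weak_topology_def using U by (intro topology_generated_by_Basis) blast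
    with lim U show "\<forall>\<^sub>F n in F. blinfun_apply f (x n) \<in> U"
      unfolding limitin_def by fastforce
  qed
next
  assume lim: "\<forall>f :: 'a \<Rightarrow>\<^sub>L real. ((\<lambda>n. blinfun_apply f (x n)) \<longlongrightarrow> blinfun_apply f l) F"
  have "l \<in> W \<longrightarrow> (\<forall>\<^sub>F n in F. x n \<in> W)"
    if "generate_topology_on {blinfun_apply f -` U | (f :: 'a \<Rightarrow>\<^sub>L real) U. open U} W" for W
    using that
  proof (induction rule: generate_topology_on.induct)
    case Empty
    then show ?case by simp
  next
    case (Int a b)
    then show ?case by (auto intro: eventually_conj)
  next
    case (UN K)
    show ?case
    proof
      assume "l \<in> \<Union>K"
      then obtain k where "k \<in> K" "l \<in> k" by blast
      then show "\<forall>\<^sub>F n in F. x n \<in> \<Union>K"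
        using UN.IH[of k] by (auto elim: eventually_mono)
    qed
  next
    case (Basis s)
    then obtain f :: "'a \<Rightarrow>\<^sub>L real" and U where s: "s = blinfun_apply f -` U" and U: "open U"
      by blast
    show ?case
      unfolding s vimage_eq using lim U topological_tendstoD by blast
  qed
  then have "l \<in> W \<longrightarrow> (\<forall>\<^sub>F n in F. x n \<in> W)" if "openin weak_topology W" for W
    using that unfolding weak_topology_def openin_topology_generated_by_iff by blast
  then show "limitin weak_topology x l F"
    by (simp add: limitin_def)
qed

definition weakly_seq_closed :: "'a::real_normed_vector set \<Rightarrow> bool" where
  "weakly_seq_closed S \<longleftrightarrow>
     (\<forall>x l. (\<forall>n. x n \<in> S) \<and> limitin weak_topology x l sequentially \<longrightarrow> l \<in> S)"

definition data_topology :: "('a::real_normed_vector \<times> 'a) topology" where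
  "data_topology = topology_generated_by
     {(A \<times> A') \<inter> {(z, z'). z - z' \<in> C} | A A' C.
        openin weak_topology A \<and> openin weak_topology A' \<and> open C}"

lemma topspace_data_topology [simp]: "topspace data_topology = UNIV"
proof -
  let ?U = "UNIV :: 'a set"
  have "openin weak_topology ?U"
    using openin_topspace[of "weak_topology :: 'a topology"] by simp
  moreover have "(UNIV :: ('a \<times> 'a) set) = (?U \<times> ?U) \<inter> {(z, z'). z - z' \<in> ?U}"
    by simp
  ultimately have "(UNIV :: ('a \<times> 'a) set) \<in> {(A \<times> A') \<inter> {(z, z'). z - z' \<in> C} | A A' C.
        openin weak_topology A \<and> openin weak_topology A' \<and> open C}"
    using open_UNIV by blast
  then show ?thesis
    unfolding data_topology_def topology_generated_by_topspace by (intro equalityI subset_UNIV Union_upper)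
qed

text \<open>Data convergence of sequences is defined directly, not as convergence in
  \<^const>\<open>data_topology\<close>.\<close>

definition data_lim ::
    "(nat \<Rightarrow> 'a::real_normed_vector) \<Rightarrow> (nat \<Rightarrow> 'a) \<Rightarrow> 'a \<Rightarrow> 'a \<Rightarrow> bool" where
  "data_lim ys zs y z \<longleftrightarrow>
     limitin weak_topology ys y sequentially \<and>
     limitin weak_topology zs z sequentially \<and>
     (\<lambda>h. ys h - zs h) \<longlonglongrightarrow> y - z"

text \<open>The indicator function of variational analysis, unlike the library's \<^const>\<open>indicator\<close>.\<close>

definition inf_indicator :: "'a set \<Rightarrow> 'a \<Rightarrow> ereal" where
  "inf_indicator A x = (if x \<in> A then 0 else \<infinity>)"

definition gamma_limit :: "'a topology \<Rightarrow> (nat \<Rightarrow> 'a \<Rightarrow> ereal) \<Rightarrow> ('a \<Rightarrow> ereal) \<Rightarrow> bool" where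
  "gamma_limit T fs f \<longleftrightarrow>
     (\<forall>p \<in> topspace T.
        f p = (SUP U \<in> {U. openin T U \<and> p \<in> U}. liminf (\<lambda>h. INF q \<in> U. fs h q)) \<and>
        f p = (SUP U \<in> {U. openin T U \<and> p \<in> U}. limsup (\<lambda>h. INF q \<in> U. fs h q)))"

definition kuratowski_limit :: "'a topology \<Rightarrow> (nat \<Rightarrow> 'a set) \<Rightarrow> 'a set \<Rightarrow> bool" where
  "kuratowski_limit T Ss S \<longleftrightarrow> gamma_limit T (\<lambda>h. inf_indicator (Ss h)) (inf_indicator S)"

definition data_functional ::
    "'a::real_normed_vector set \<Rightarrow> 'a set \<Rightarrow> 'a \<Rightarrow> 'a \<Rightarrow> ereal" where
  "data_functional D E y z = inf_indicator D y + inf_indicator E z + ereal ((norm (y - z))\<^sup>2)"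

end

theory Submission
  imports Defs "HOL-Complex_Analysis.Great_Picard"
begin

text \<open>
  Along a sequence whose data functionals tend to zero, the points
  eventually lie in the constraint sets and \<open>ys h - zs h\<close> tends to zero; transversality turns the
  bound on the differences into a bound on the points themselves.

  Compactness: in a separable reflexive space a bounded sequence has a weakly convergent
  subsequence, so a subsequence of \<open>zs\<close> tends weakly to some \<open>z\<close>.  Because the differences tend to
  zero in norm, the pairs tend to \<open>(z, z)\<close> in the data topology.  A point outside a Kuratowski
  limit has a neighbourhood that eventually misses the approximating sets, so \<open>(z, z)\<close> must belong
  to \<open>D \<times> E\<close>.

  Recovery: a Kuratowski limit provides, for each neighbourhood of \<open>(z, z)\<close>, points of
  \<open>Dh h \<times> E\<close> in that neighbourhood for all large \<open>h\<close>.  Extracting one sequence from this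
  needs countably many neighbourhoods, whereas the data topology need not be first countable.
  Transversality helps again: all relevant points lie in a fixed ball, and there
  countably many functionals with dense span decide weak convergence.  Neighbourhoods built from
  these functionals suffice, and a diagonal choice of indices gives the sequence.

  Both halves rest on such a countable family of functionals.  That it exists is shown by the
  Hahn-Banach theorem, used twice: in the space, to obtain functionals that norm the points of a
  countable dense set, and in the dual, to see that their span is dense.  Here the Hahn-Banach
  theorem is obtained by showing that a minimal sublinear functional is linear.\<close>

section \<open>The Hahn-Banach theorem for sublinear functionals\<close>

definition sublinear :: "('a::real_vector \<Rightarrow> real) \<Rightarrow> bool" where
  "sublinear p \<longleftrightarrow>
     (\<forall>x y. p (x + y) \<le> p x + p y) \<and> (\<forall>t x. t > 0 \<longrightarrow> p (t *\<^sub>R x) = t * p x)"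

lemma sublinearI:
  assumes add: "\<And>x y. p (x + y) \<le> p x + p y"
    and scale: "\<And>t x. t > 0 \<Longrightarrow> p (t *\<^sub>R x) \<le> t * p x"
  shows "sublinear p"
proof -
  have "t * p x \<le> p (t *\<^sub>R x)" if "t > 0" for t x
    using scale[of "inverse t" "t *\<^sub>R x"] that by (simp add: field_simps)
  then show ?thesis
    unfolding sublinear_def using add scale by (auto intro: antisym)
qed

lemma sublinear_add: "sublinear p \<Longrightarrow> p (x + y) \<le> p x + p y"
  and sublinear_scale: "sublinear p \<Longrightarrow> t > 0 \<Longrightarrow> p (t *\<^sub>R x) = t * p x"
  by (simp_all add: sublinear_def)

lemma sublinear_zero: "sublinear p \<Longrightarrow> p 0 = 0"
  using sublinear_scale[of p 2 0] by simp

lemma sublinear_scale_nonneg: "sublinear p \<Longrightarrow> t \<ge> 0 \<Longrightarrow> p (t *\<^sub>R x) = t * p x"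
  by (cases "t = 0") (auto simp: sublinear_zero sublinear_scale)

lemma sublinear_minus: "sublinear p \<Longrightarrow> - p (- x) \<le> p x"
  using sublinear_add[of p x "- x"] sublinear_zero[of p] by simp

lemma le_INF_add_INF:
  fixes f g :: "'i \<Rightarrow> real"
  assumes ne: "S \<noteq> {}" and le: "\<And>s t. s \<in> S \<Longrightarrow> t \<in> S \<Longrightarrow> h \<le> f s + g t"
  shows "h \<le> (INF s\<in>S. f s) + (INF t\<in>S. g t)"
proof -
  have "h - f s \<le> (INF t\<in>S. g t)" if "s \<in> S" for s
    by (rule cINF_greatest[OF ne]) (use le[OF that] in \<open>simp add: algebra_simps\<close>)
  then have "h - (INF t\<in>S. g t) \<le> (INF s\<in>S. f s)"
    by (intro cINF_greatest[OF ne]) (simp add: algebra_simps)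
  then show ?thesis
    by simp
qed

text \<open>The gauge obtained from \<open>p\<close> by allowing a free shift along \<open>y\<close>, charged at the rate \<open>p y\<close>.
  Its value at \<open>- y\<close> is at most \<open>- p y\<close> (take \<open>t = 1\<close>), so every linear functional below it is
  at least \<open>p y\<close> at \<open>y\<close>.\<close>

definition directional_reduction :: "('a::real_vector \<Rightarrow> real) \<Rightarrow> 'a \<Rightarrow> 'a \<Rightarrow> real" where
  "directional_reduction p y x = (INF t\<in>{0..}. p (x + t *\<^sub>R y) - t * p y)"

lemma directional_reduction_le:
  assumes p: "sublinear p" and t: "t \<ge> 0"
  shows "directional_reduction p y x \<le> p (x + t *\<^sub>R y) - t * p y"
proof -
  have "- p (- x) \<le> p (x + s *\<^sub>R y) - s * p y" if "s \<ge> 0" for s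
    using sublinear_add[OF p, of "x + s *\<^sub>R y" "- x"] sublinear_scale_nonneg[OF p that, of y]
    by simp
  then have "bdd_below ((\<lambda>s. p (x + s *\<^sub>R y) - s * p y) ` {0..})"
    by (intro bdd_belowI2[where m = "- p (- x)"]) auto
  then show ?thesis
    unfolding directional_reduction_def using t by (intro cINF_lower) auto
qed

lemma directional_reduction_le_self:
  "sublinear p \<Longrightarrow> directional_reduction p y x \<le> p x"
  using directional_reduction_le[of p 0 y x] by simp

lemma sublinear_directional_reduction:
  assumes p: "sublinear p"
  shows "sublinear (directional_reduction p y)" (is "sublinear ?q")
proof (rule sublinearI)
  fix a b
  show "?q (a + b) \<le> ?q a + ?q b"
    unfolding directional_reduction_def[of p y a] directional_reduction_def[of p y b]
  proof (rule le_INF_add_INF)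
    fix s t :: real
    assume "s \<in> {0..}" "t \<in> {0..}"
    then have "?q (a + b) \<le> p ((a + b) + (s + t) *\<^sub>R y) - (s + t) * p y"
      by (intro directional_reduction_le[OF p]) auto
    also have "(a + b) + (s + t) *\<^sub>R y = (a + s *\<^sub>R y) + (b + t *\<^sub>R y)"
      by (simp add: algebra_simps)
    also have "p \<dots> - (s + t) * p y \<le> (p (a + s *\<^sub>R y) - s * p y) + (p (b + t *\<^sub>R y) - t * p y)"
      using sublinear_add[OF p, of "a + s *\<^sub>R y" "b + t *\<^sub>R y"] by (simp add: algebra_simps)
    finally show "?q (a + b) \<le> (p (a + s *\<^sub>R y) - s * p y) + (p (b + t *\<^sub>R y) - t * p y)" .
  qed auto
next
  fix r :: real and x
  assume r: "r > 0"
  have "?q (r *\<^sub>R x) / r \<le> ?q x"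
    unfolding directional_reduction_def[of p y x]
  proof (rule cINF_greatest)
    fix t :: real
    assume "t \<in> {0..}"
    then have "?q (r *\<^sub>R x) \<le> p (r *\<^sub>R x + (r * t) *\<^sub>R y) - (r * t) * p y"
      using r by (intro directional_reduction_le[OF p]) auto
    also have "p (r *\<^sub>R x + (r * t) *\<^sub>R y) = r * p (x + t *\<^sub>R y)"
      using sublinear_scale[OF p r, of "x + t *\<^sub>R y"] by (simp add: scaleR_add_right)
    finally have "?q (r *\<^sub>R x) \<le> (p (x + t *\<^sub>R y) - t * p y) * r"
      by (simp add: algebra_simps)
    then show "?q (r *\<^sub>R x) / r \<le> p (x + t *\<^sub>R y) - t * p y"
      using r by (simp only: pos_divide_le_eq)
  qed auto
  then show "?q (r *\<^sub>R x) \<le> r * ?q x"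
    using r by (simp add: field_simps)
qed

text \<open>Subadditivity of the infimum uses that the family is a chain: the smaller of two members
  can be used at both points.\<close>

lemma sublinear_INF_chain:
  assumes ne: "C \<noteq> {}" and sub: "\<And>q. q \<in> C \<Longrightarrow> sublinear q \<and> q \<le> p"
    and chain: "\<And>q r. q \<in> C \<Longrightarrow> r \<in> C \<Longrightarrow> q \<le> r \<or> r \<le> q"
  shows "sublinear (\<lambda>x. INF q\<in>C. q x)" (is "sublinear ?m")
    and "q \<in> C \<Longrightarrow> (\<lambda>x. INF q\<in>C. q x) \<le> q"
proof -
  have lower: "?m x \<le> q x" if "q \<in> C" for q x
  proof (rule cINF_lower[OF _ that])
    have "- p (- x) \<le> r x" if "r \<in> C" for r
      using sublinear_minus[of r x] sub[OF that] by (force simp: le_fun_def dest: spec[of _ "- x"])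
    then show "bdd_below ((\<lambda>q. q x) ` C)"
      by (rule bdd_belowI2)
  qed
  then show "q \<in> C \<Longrightarrow> ?m \<le> q"
    by (simp add: le_fun_def)
  show "sublinear ?m"
  proof (rule sublinearI)
    fix a b
    show "?m (a + b) \<le> ?m a + ?m b"
    proof (rule le_INF_add_INF[OF ne])
      fix q r
      assume q: "q \<in> C" and r: "r \<in> C"
      have "?m (a + b) \<le> q a + q b" "?m (a + b) \<le> r a + r b"
        using lower[OF q, of "a + b"] lower[OF r, of "a + b"]
          sublinear_add[of q a b] sublinear_add[of r a b] sub q r by force+
      then show "?m (a + b) \<le> q a + r b"
        using chain[OF q r] by (auto simp: le_fun_def intro: order_trans)
    qed
  next
    fix t :: real and x
    assume t: "t > 0"
    have "?m (t *\<^sub>R x) / t \<le> ?m x"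
    proof (rule cINF_greatest[OF ne])
      fix q
      assume "q \<in> C"
      then show "?m (t *\<^sub>R x) / t \<le> q x"
        using lower[of q "t *\<^sub>R x"] sublinear_scale[of q t x] sub t by (simp add: field_simps)
    qed
    then show "?m (t *\<^sub>R x) \<le> t * ?m x"
      using t by (simp add: field_simps)
  qed
qed

text \<open>A minimal sublinear functional \<open>m\<close> coincides with all its directional reductions. Hence
  \<open>m x \<le> m (x + y) - m y\<close>, so \<open>m\<close> is superadditive as well as subadditive.\<close>

lemma minimal_sublinear_linear:
  assumes m: "sublinear m" and minimal: "\<And>q. sublinear q \<Longrightarrow> q \<le> m \<Longrightarrow> q = m"
  shows "linear m"
proof -
  have "directional_reduction m y = m" for y
    by (intro minimal sublinear_directional_reduction m)
       (simp add: le_fun_def directional_reduction_le_self[OF m])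
  then have "m x \<le> m (x + y) - m y" for x y
    using directional_reduction_le[OF m, of 1 y x] by simp
  then have add: "m (x + y) = m x + m y" for x y
    using sublinear_add[OF m, of x y] by (smt (verit))
  then have minus: "m (- x) = - m x" for x
    using add[of x "- x"] sublinear_zero[OF m] by simp
  have "m (t *\<^sub>R x) = t * m x" for t x
  proof (cases "t \<ge> 0")
    case False
    then show ?thesis
      using sublinear_scale[OF m, of "- t" x] minus[of "t *\<^sub>R x"] by simp
  qed (rule sublinear_scale_nonneg[OF m])
  with add show ?thesis
    by (intro linearI) auto
qed

lemma exists_minimal_sublinear_le:
  assumes p: "sublinear p"
  obtains m where "sublinear m" "m \<le> p" "\<And>q. sublinear q \<Longrightarrow> q \<le> m \<Longrightarrow> q = m"
proof -
  define A where "A = {q. sublinear q \<and> q \<le> p}"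
  have "\<exists>m\<in>A. \<forall>q\<in>A. q \<le> m \<longrightarrow> q = m"
  proof (rule predicate_Zorn)
    show "partial_order_on A (relation_of (\<lambda>q r. r \<le> q) A)"
      by (rule partial_order_on_relation_ofI) auto
  next
    fix C
    assume C: "C \<in> Chains (relation_of (\<lambda>q r. r \<le> q) A)"
    show "\<exists>u\<in>A. \<forall>q\<in>C. u \<le> q"
    proof (cases "C = {}")
      case True
      then show ?thesis
        using p by (auto simp: A_def)
    next
      case False
      have sub: "sublinear q \<and> q \<le> p" if "q \<in> C" for q
        using C that by (auto simp: Chains_def relation_of_def A_def)
      have chain: "q \<le> r \<or> r \<le> q" if "q \<in> C" "r \<in> C" for q r
        using C that by (auto simp: Chains_def relation_of_def)
      obtain q where "q \<in> C"
        using False by blast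
      then have "(\<lambda>x. INF q\<in>C. q x) \<in> A"
        using sublinear_INF_chain[OF False sub chain] sub by (auto simp: A_def intro: order_trans)
      then show ?thesis
        using sublinear_INF_chain(2)[OF False sub chain] by blast
    qed
  qed
  then obtain m where "m \<in> A" and m: "\<And>q. q \<in> A \<Longrightarrow> q \<le> m \<Longrightarrow> q = m"
    by blast
  with that show ?thesis
    by (auto simp: A_def intro: order_trans)
qed

text \<open>Minimality is sought below the directional reduction of \<open>p\<close> along \<open>y\<close>, not below \<open>p\<close>
  itself; this is what makes the bound sharp at \<open>y\<close>.\<close>

theorem exists_linear_below_sublinear:
  assumes p: "sublinear p"
  obtains f where "linear f" "\<And>x. f x \<le> p x" "f y = p y"
proof -
  let ?q = "directional_reduction p y"
  obtain f where f: "sublinear f" "f \<le> ?q" "\<And>g. sublinear g \<Longrightarrow> g \<le> f \<Longrightarrow> g = f"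
    using exists_minimal_sublinear_le[OF sublinear_directional_reduction[OF p, of y]] by blast
  have lin: "linear f"
    by (rule minimal_sublinear_linear[OF f(1) f(3)])
  have le: "f x \<le> p x" for x
    using f(2) directional_reduction_le_self[OF p, of y x] by (auto simp: le_fun_def intro: order_trans)
  have "f (- y) \<le> ?q (- y)"
    using f(2) by (simp add: le_fun_def)
  also have "\<dots> \<le> - p y"
    using directional_reduction_le[OF p, of 1 y "- y"] sublinear_zero[OF p] by simp
  finally have "f y = p y"
    using le[of y] linear_neg[OF lin, of y] by simp
  with lin le that show ?thesis
    by blast
qed

lemma sublinear_infdist_subspace:
  fixes M :: "'a::real_normed_vector set"
  assumes M: "subspace M"
  shows "sublinear (\<lambda>x. infdist x M)"
proof -
  have ne: "M \<noteq> {}"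
    using subspace_0[OF M] by blast
  show ?thesis
  proof (rule sublinearI)
    fix x y :: 'a
    show "infdist (x + y) M \<le> infdist x M + infdist y M"
      unfolding infdist_notempty[OF ne, of x] infdist_notempty[OF ne, of y]
    proof (rule le_INF_add_INF[OF ne])
      fix a b
      assume "a \<in> M" "b \<in> M"
      then have "infdist (x + y) M \<le> dist (x + y) (a + b)"
        by (intro infdist_le subspace_add[OF M])
      also have "\<dots> \<le> dist x a + dist y b"
        by (rule dist_triangle_add)
      finally show "infdist (x + y) M \<le> dist x a + dist y b" .
    qed
  next
    fix t :: real and x :: 'a
    assume t: "t > 0"
    have "infdist (t *\<^sub>R x) M / t \<le> infdist x M"
      unfolding infdist_notempty[OF ne, of x]
    proof (rule cINF_greatest[OF ne])
      fix a
      assume "a \<in> M"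
      then have "infdist (t *\<^sub>R x) M \<le> dist (t *\<^sub>R x) (t *\<^sub>R a)"
        by (intro infdist_le subspace_scale[OF M])
      also have "\<dots> = dist x a * t"
        using t by (simp add: dist_norm flip: scaleR_diff_right)
      finally show "infdist (t *\<^sub>R x) M / t \<le> dist x a"
        using t by (simp only: pos_divide_le_eq)
    qed
    then show "infdist (t *\<^sub>R x) M \<le> t * infdist x M"
      using t by (simp add: field_simps)
  qed
qed

text \<open>The distance to a subspace is sublinear and vanishes on the subspace, so a linear
  functional below it is a contraction and annihilates the subspace.\<close>

theorem exists_functional_annihilating_subspace:
  fixes M :: "'a::real_normed_vector set"
  assumes M: "subspace M"
  obtains f :: "'a \<Rightarrow>\<^sub>L real"
    where "norm f \<le> 1" "\<And>x. x \<in> M \<Longrightarrow> blinfun_apply f x = 0" "blinfun_apply f y = infdist y M"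
proof -
  obtain g where g: "linear g" "\<And>x. g x \<le> infdist x M" "g y = infdist y M"
    using exists_linear_below_sublinear[OF sublinear_infdist_subspace[OF M]] by blast
  have le: "infdist x M \<le> norm x" for x
    using infdist_le[OF subspace_0[OF M], of x] by simp
  have bound: "\<bar>g x\<bar> \<le> norm x" for x
    using g(2)[of x] g(2)[of "- x"] le[of x] le[of "- x"] linear_neg[OF g(1), of x] by simp
  have bl: "bounded_linear g"
    using g(1) bound by (intro bounded_linear_intro[where K = 1]) (auto simp: linear_add linear_scale)
  have zero: "g x = 0" if "x \<in> M" for x
    using g(2)[of x] g(2)[of "- x"] that subspace_neg[OF M that] linear_neg[OF g(1), of x] by simp
  show ?thesis
  proof (rule that[of "Blinfun g"])
    show "norm (Blinfun g) \<le> 1"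
      using bound by (intro norm_blinfun_bound) (auto simp: bounded_linear_Blinfun_apply[OF bl])
  qed (use g zero in \<open>auto simp: bounded_linear_Blinfun_apply[OF bl]\<close>)
qed

corollary exists_norming_functional:
  fixes y :: "'a::real_normed_vector"
  obtains f :: "'a \<Rightarrow>\<^sub>L real" where "norm f \<le> 1" "blinfun_apply f y = norm y"
  using exists_functional_annihilating_subspace[of "{0}" y] by (auto simp: infdist_singleton)

section \<open>Weak convergence in separable reflexive spaces\<close>

text \<open>Let \<open>G\<close> consist of norming functionals for the points of a countable dense set. By
  reflexivity, a functional on the dual that annihilates \<open>G\<close> is evaluation at some \<open>x\<close>, and the
  norming functional of a dense point \<open>d\<close> shows \<open>norm d \<le> norm (d - x)\<close>; letting \<open>d\<close> tend to \<open>x\<close>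
  gives \<open>x = 0\<close>. So the Hahn-Banach theorem, applied in the dual, makes the span of \<open>G\<close> dense.\<close>

lemma reflexive_separable_dual_dense_span:
  assumes reflexive: "reflexive_space TYPE('a::real_normed_vector)"
    and separable: "separable_space (euclidean :: 'a::real_normed_vector topology)"
  obtains G :: "('a::real_normed_vector \<Rightarrow>\<^sub>L real) set"
    where "countable G" "G \<noteq> {}" "\<And>g. g \<in> G \<Longrightarrow> norm g \<le> 1" "closure (span G) = UNIV"
proof -
  obtain D :: "'a set" where D: "countable D" "closure D = UNIV"
    using separable by (auto simp: separable_space_def)
  have "\<exists>f :: 'a \<Rightarrow>\<^sub>L real. norm f \<le> 1 \<and> blinfun_apply f d = norm d" for d
    using exists_norming_functional by metis
  then obtain J :: "'a \<Rightarrow> 'a \<Rightarrow>\<^sub>L real"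
    where J: "\<And>d. norm (J d) \<le> 1" "\<And>d. blinfun_apply (J d) d = norm d"
    by metis
  have "F \<in> closure (span (J ` D))" for F
  proof -
    obtain \<phi> :: "('a \<Rightarrow>\<^sub>L real) \<Rightarrow>\<^sub>L real" where
      \<phi>: "\<And>g. g \<in> span (J ` D) \<Longrightarrow> blinfun_apply \<phi> g = 0" "blinfun_apply \<phi> F = infdist F (span (J ` D))"
      using exists_functional_annihilating_subspace[OF subspace_span] by metis
    obtain x :: 'a where x: "\<And>f. blinfun_apply \<phi> f = blinfun_apply f x"
      using reflexive unfolding reflexive_space_def by blast
    have "norm x \<le> e" if "e > 0" for e
    proof -
      obtain d where d: "d \<in> D" "dist d x < e / 2"
        using D(2) \<open>e > 0\<close> closure_approachable[of x D] half_gt_zero by blast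
      have "blinfun_apply (J d) x = 0"
        using x[of "J d"] \<phi>(1)[of "J d"] d(1) by (simp add: span_base)
      then have "norm d = blinfun_apply (J d) (d - x)"
        by (simp add: blinfun.diff_right J(2))
      also have "\<dots> \<le> norm (J d) * norm (d - x)"
        using norm_blinfun[of "J d" "d - x"] by simp
      also have "\<dots> \<le> norm (d - x)"
        using mult_right_mono[OF J(1)[of d], of "norm (d - x)"] by simp
      finally show ?thesis
        using d(2) norm_triangle_ineq4[of d "d - x"] by (simp add: dist_norm)
    qed
    then have "x = 0"
      using field_le_epsilon[of "norm x" 0] by simp
    then have "infdist F (span (J ` D)) = 0"
      using \<phi>(2) x[of F] by simp
    moreover have "span (J ` D) \<noteq> {}"
      using span_zero by blast
    ultimately show ?thesis
      by (simp add: in_closure_iff_infdist_zero)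
  qed
  moreover have "D \<noteq> {}"
    using D(2) by auto
  ultimately show ?thesis
    using that[of "J ` D"] D(1) J(1) by auto
qed

text \<open>For a net bounded by \<open>R\<close>, the functionals along which it tends to zero form a closed
  subspace of the dual. The filter is arbitrary because the lemma also serves for the differences
  \<open>x m - x n\<close> of a sequence, indexed by pairs.\<close>

lemma functional_tendsto_zero_closure_span:
  fixes x :: "'i \<Rightarrow> 'a::real_normed_vector" and G :: "('a \<Rightarrow>\<^sub>L real) set"
  assumes bounded: "\<forall>\<^sub>F i in F. norm (x i) \<le> R"
    and G: "\<And>g. g \<in> G \<Longrightarrow> ((\<lambda>i. blinfun_apply g (x i)) \<longlongrightarrow> 0) F"
    and f: "f \<in> closure (span G)"
  shows "((\<lambda>i. blinfun_apply f (x i)) \<longlongrightarrow> 0) F"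
proof (rule tendstoI)
  fix e :: real
  assume e: "e > 0"
  \<comment> \<open>\<open>R\<close> may be zero or negative, and is used as a divisor.\<close>
  define K where "K = max R 1"
  have K: "K > 0" "R \<le> K"
    by (auto simp: K_def)
  obtain g where g: "g \<in> span G" "dist g f < e / 2 / K"
    using f e K closure_approachable[of f "span G"] by (meson divide_pos_pos half_gt_zero)
  have "((\<lambda>i. blinfun_apply g (x i)) \<longlongrightarrow> 0) F"
    using g(1)
  proof (induction rule: span_induct)
    case base
    show ?case
      by (rule subspaceI)
         (auto simp: blinfun.add_left blinfun.scaleR_left intro!: tendsto_add_zero tendsto_mult_right_zero)
  qed (rule G)
  then have "\<forall>\<^sub>F i in F. \<bar>blinfun_apply g (x i)\<bar> < e / 2"
    using e by (auto dest!: tendstoD[where e = "e / 2"])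
  then show "\<forall>\<^sub>F i in F. dist (blinfun_apply f (x i)) 0 < e"
    using bounded
  proof eventually_elim
    case (elim i)
    have "\<bar>blinfun_apply (f - g) (x i)\<bar> \<le> norm (f - g) * norm (x i)"
      using norm_blinfun[of "f - g" "x i"] by simp
    also have "\<dots> \<le> e / 2 / K * K"
      using g(2) elim K by (intro mult_mono) (auto simp: dist_norm norm_minus_commute)
    finally have "\<bar>blinfun_apply f (x i) - blinfun_apply g (x i)\<bar> \<le> e / 2"
      using K by (simp add: blinfun.diff_left)
    moreover have "\<bar>blinfun_apply f (x i)\<bar> \<le>
        \<bar>blinfun_apply f (x i) - blinfun_apply g (x i)\<bar> + \<bar>blinfun_apply g (x i)\<bar>"
      by simp
    ultimately have "\<bar>blinfun_apply f (x i)\<bar> < e"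
      using elim by linarith
    then show ?case
      by simp
  qed
qed

lemma limitin_weak_topology_dense_span:
  fixes x :: "'i \<Rightarrow> 'a::real_normed_vector" and G :: "('a \<Rightarrow>\<^sub>L real) set"
  assumes bounded: "\<forall>\<^sub>F i in F. norm (x i) \<le> R"
    and dense: "closure (span G) = UNIV"
    and G: "\<And>g. g \<in> G \<Longrightarrow> ((\<lambda>i. blinfun_apply g (x i)) \<longlongrightarrow> blinfun_apply g l) F"
  shows "limitin weak_topology x l F"
proof -
  have "((\<lambda>i. blinfun_apply f (x i - l)) \<longlongrightarrow> 0) F" for f :: "'a \<Rightarrow>\<^sub>L real"
  proof (rule functional_tendsto_zero_closure_span)
    show "\<forall>\<^sub>F i in F. norm (x i - l) \<le> R + norm l"
      using bounded by eventually_elim (use norm_triangle_ineq4 in \<open>fastforce intro: order_trans\<close>)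
    show "((\<lambda>i. blinfun_apply g (x i - l)) \<longlongrightarrow> 0) F" if "g \<in> G" for g
      using LIM_zero[OF G[OF that]] by (simp add: blinfun.diff_right)
  qed (use dense in auto)
  then show ?thesis
    unfolding limitin_weak_topology_iff by (auto simp: blinfun.diff_right intro: LIM_zero_cancel)
qed

lemma Cauchy_iff_tendsto_diff:
  fixes X :: "nat \<Rightarrow> 'a::real_normed_vector"
  shows "Cauchy X \<longleftrightarrow> ((\<lambda>i. X (fst i) - X (snd i)) \<longlongrightarrow> 0) (sequentially \<times>\<^sub>F sequentially)"
  by (fastforce simp: Cauchy_iff tendsto_iff eventually_prod_sequentially)

text \<open>A diagonal subsequence converges along a countable set \<open>G\<close> of functionals with dense span,
  hence is Cauchy along every functional. The pointwise limit is a bounded functional on the dual,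
  and reflexivity represents it by a point, the weak limit.\<close>

theorem bounded_weakly_convergent_subsequence:
  fixes x :: "nat \<Rightarrow> 'a::real_normed_vector"
  assumes reflexive: "reflexive_space TYPE('a)"
    and separable: "separable_space (euclidean :: 'a topology)"
    and bounded: "\<And>n. norm (x n) \<le> R"
  obtains l r where "strict_mono (r :: nat \<Rightarrow> nat)" "limitin weak_topology (x \<circ> r) l sequentially"
proof -
  obtain G :: "('a \<Rightarrow>\<^sub>L real) set"
    where G: "countable G" "\<And>g. g \<in> G \<Longrightarrow> norm g \<le> 1" "closure (span G) = UNIV"
    using reflexive_separable_dual_dense_span[OF reflexive separable] by metis
  have "norm (blinfun_apply g (x n)) \<le> R" if "g \<in> G" for g n
    using norm_blinfun[of g "x n"] mult_mono[OF G(2)[OF that] bounded[of n]] by simp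
  then obtain r where r: "strict_mono (r :: nat \<Rightarrow> nat)"
    and conv: "\<And>g. g \<in> G \<Longrightarrow> \<exists>l. (\<lambda>n. blinfun_apply g (x (r n))) \<longlonglongrightarrow> l"
    using function_convergent_subsequence[OF G(1), of "\<lambda>n g. blinfun_apply g (x n)" R] by metis
  have "Cauchy (\<lambda>n. blinfun_apply f (x (r n)))" for f :: "'a \<Rightarrow>\<^sub>L real"
  proof -
    have "((\<lambda>i. blinfun_apply f (x (r (fst i)) - x (r (snd i)))) \<longlongrightarrow> 0) (sequentially \<times>\<^sub>F sequentially)"
    proof (rule functional_tendsto_zero_closure_span)
      have "norm (x (r m) - x (r n)) \<le> R + R" for m n
        using norm_triangle_ineq4[of "x (r m)" "x (r n)"] bounded[of "r m"] bounded[of "r n"] by simp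
      then show "\<forall>\<^sub>F i in sequentially \<times>\<^sub>F sequentially. norm (x (r (fst i)) - x (r (snd i))) \<le> R + R"
        by simp
      show "((\<lambda>i. blinfun_apply g (x (r (fst i)) - x (r (snd i)))) \<longlongrightarrow> 0) (sequentially \<times>\<^sub>F sequentially)"
        if "g \<in> G" for g
      proof -
        have "Cauchy (\<lambda>n. blinfun_apply g (x (r n)))"
          using conv[OF that] LIMSEQ_imp_Cauchy by blast
        then show ?thesis
          by (simp add: Cauchy_iff_tendsto_diff blinfun.diff_right)
      qed
    qed (use G(3) in auto)
    then show ?thesis
      by (simp add: Cauchy_iff_tendsto_diff blinfun.diff_right)
  qed
  then have "\<exists>l. (\<lambda>n. blinfun_apply f (x (r n))) \<longlonglongrightarrow> l" for f :: "'a \<Rightarrow>\<^sub>L real"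
    using Cauchy_convergent convergent_def by blast
  then obtain \<phi> where \<phi>: "\<And>f :: 'a \<Rightarrow>\<^sub>L real. (\<lambda>n. blinfun_apply f (x (r n))) \<longlonglongrightarrow> \<phi> f"
    by metis
  have "bounded_linear \<phi>"
  proof (rule bounded_linear_intro)
    show "\<phi> (f + g) = \<phi> f + \<phi> g" for f g
      using LIMSEQ_unique[OF \<phi>[of "f + g"]] tendsto_add[OF \<phi>[of f] \<phi>[of g]]
      by (simp add: blinfun.add_left)
    show "\<phi> (c *\<^sub>R f) = c *\<^sub>R \<phi> f" for c f
      using LIMSEQ_unique[OF \<phi>[of "c *\<^sub>R f"]] tendsto_mult_left[OF \<phi>[of f], of c]
      by (simp add: blinfun.scaleR_left)
    show "norm (\<phi> f) \<le> norm f * R" for f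
    proof (rule Lim_norm_ubound[OF _ \<phi>])
      have "norm (blinfun_apply f (x (r n))) \<le> norm f * R" for n
        using norm_blinfun[of f "x (r n)"] mult_left_mono[OF bounded[of "r n"], of "norm f"] by simp
      then show "\<forall>\<^sub>F n in sequentially. norm (blinfun_apply f (x (r n))) \<le> norm f * R"
        by simp
    qed simp
  qed
  then obtain l :: 'a where "\<And>f. \<phi> f = blinfun_apply f l"
    using reflexive bounded_linear_Blinfun_apply unfolding reflexive_space_def by metis
  then have "limitin weak_topology (x \<circ> r) l sequentially"
    using \<phi> by (simp add: limitin_weak_topology_iff)
  with r that show ?thesis
    by blast
qed

section \<open>Data convergence and Kuratowski limits\<close>

lemma INF_inf_indicator: "(INF q\<in>U. inf_indicator S q) = (if U \<inter> S = {} then \<infinity> else 0)"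
proof (cases "U \<inter> S = {}")
  case True
  then have "inf_indicator S q = \<infinity>" if "q \<in> U" for q
    using that by (auto simp: inf_indicator_def)
  with True show ?thesis
    by (cases "U = {}") (auto simp: top_ereal_def)
next
  case False
  then obtain q where q: "q \<in> U" "q \<in> S"
    by blast
  have "(INF q\<in>U. inf_indicator S q) = 0"
  proof (rule antisym)
    show "(INF q\<in>U. inf_indicator S q) \<le> 0"
      using q by (intro INF_lower2[of q]) (auto simp: inf_indicator_def)
    show "0 \<le> (INF q\<in>U. inf_indicator S q)"
      by (rule INF_greatest) (simp add: inf_indicator_def)
  qed
  with False show ?thesis
    by simp
qed

text \<open>The infima of an indicator take only the values \<open>0\<close> and \<open>\<infinity>\<close>, so a bound on the upper or
  lower limit that excludes one of the values fixes the infimum for all large \<open>h\<close>.\<close>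

lemma kuratowski_limit_eventually_meets:
  assumes K: "kuratowski_limit T Ss S" and p: "p \<in> S" "p \<in> U" "openin T U"
  shows "\<forall>\<^sub>F h in sequentially. U \<inter> Ss h \<noteq> {}"
proof -
  have "p \<in> topspace T"
    using p openin_subset by blast
  then have "inf_indicator S p =
      (SUP U \<in> {U. openin T U \<and> p \<in> U}. limsup (\<lambda>h. INF q\<in>U. inf_indicator (Ss h) q))"
    using K unfolding kuratowski_limit_def gamma_limit_def by blast
  moreover have "limsup (\<lambda>h. INF q\<in>U. inf_indicator (Ss h) q) \<le>
      (SUP U \<in> {U. openin T U \<and> p \<in> U}. limsup (\<lambda>h. INF q\<in>U. inf_indicator (Ss h) q))"
    using p by (intro SUP_upper) simp
  ultimately have "limsup (\<lambda>h. INF q\<in>U. inf_indicator (Ss h) q) \<le> 0"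
    using p(1) by (simp only: inf_indicator_def[of S p] if_True)
  then have "limsup (\<lambda>h. INF q\<in>U. inf_indicator (Ss h) q) < 1"
    by (rule order_le_less_trans) simp
  from Limsup_lessD[OF this] show ?thesis
    by eventually_elim (auto simp: INF_inf_indicator split: if_splits)
qed

lemma kuratowski_limit_eventually_misses:
  assumes K: "kuratowski_limit T Ss S" and p: "p \<in> topspace T" "p \<notin> S"
  obtains U where "openin T U" "p \<in> U" "\<forall>\<^sub>F h in sequentially. U \<inter> Ss h = {}"
proof -
  have "inf_indicator S p =
      (SUP U \<in> {U. openin T U \<and> p \<in> U}. liminf (\<lambda>h. INF q\<in>U. inf_indicator (Ss h) q))"
    using K p(1) unfolding kuratowski_limit_def gamma_limit_def by blast
  moreover have "0 < inf_indicator S p"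
    using p(2) by (simp add: inf_indicator_def)
  ultimately have "0 < (SUP U \<in> {U. openin T U \<and> p \<in> U}. liminf (\<lambda>h. INF q\<in>U. inf_indicator (Ss h) q))"
    by (simp only:)
  then obtain U where U: "openin T U" "p \<in> U"
    and pos: "0 < liminf (\<lambda>h. INF q\<in>U. inf_indicator (Ss h) q)"
    unfolding less_SUP_iff by blast
  from less_LiminfD[OF pos] have "\<forall>\<^sub>F h in sequentially. U \<inter> Ss h = {}"
    by eventually_elim (auto simp: INF_inf_indicator split: if_splits)
  with U that show ?thesis
    by blast
qed

lemma openin_data_topology_Basis:
  assumes "openin weak_topology A" "openin weak_topology A'" "open C"
  shows "openin data_topology ((A \<times> A') \<inter> {(z, z'). z - z' \<in> C})"
  unfolding data_topology_def using assms by (intro topology_generated_by_Basis) blast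

text \<open>It is enough to test the generating sets of the data topology: the open sets in which a
  sequence eventually stays, once they contain its limit, are stable under finite intersections
  and arbitrary unions.\<close>

lemma data_lim_imp_limitin:
  assumes "data_lim ys zs y z"
  shows "limitin data_topology (\<lambda>h. (ys h, zs h)) (y, z) sequentially"
proof -
  have "(y, z) \<in> W \<longrightarrow> (\<forall>\<^sub>F h in sequentially. (ys h, zs h) \<in> W)"
    if "generate_topology_on {(A \<times> A') \<inter> {(z, z'). z - z' \<in> C} | A A' C.
        openin weak_topology A \<and> openin weak_topology A' \<and> open C} W" for W
    using that
  proof (induction rule: generate_topology_on.induct)
    case Empty
    then show ?case by simp
  next
    case (Int a b)
    then show ?case by (auto intro: eventually_conj)
  next
    case (UN K)
    then show ?case by (blast intro: eventually_mono)
  next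
    case (Basis s)
    then obtain A A' C where s: "s = (A \<times> A') \<inter> {(z, z'). z - z' \<in> C}"
      and o: "openin weak_topology A" "openin weak_topology A'" "open C"
      by blast
    show ?case
    proof
      assume "(y, z) \<in> s"
      then have "\<forall>\<^sub>F h in sequentially. ys h \<in> A" "\<forall>\<^sub>F h in sequentially. zs h \<in> A'"
        "\<forall>\<^sub>F h in sequentially. ys h - zs h \<in> C"
        using assms o unfolding s data_lim_def limitin_def by (auto dest: topological_tendstoD)
      then show "\<forall>\<^sub>F h in sequentially. (ys h, zs h) \<in> s"
        by eventually_elim (simp add: s)
    qed
  qed
  then have "(y, z) \<in> W \<longrightarrow> (\<forall>\<^sub>F h in sequentially. (ys h, zs h) \<in> W)"
    if "openin data_topology W" for W
    using that unfolding data_topology_def openin_topology_generated_by_iff by blast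
  then show ?thesis
    by (simp add: limitin_def)
qed

lemma kuratowski_limit_data_lim_mem:
  assumes K: "kuratowski_limit data_topology Ss S" and r: "strict_mono r"
    and lim: "data_lim ys zs y z"
    and mem: "\<forall>\<^sub>F n in sequentially. (ys n, zs n) \<in> Ss (r n)"
  shows "(y, z) \<in> S"
proof (rule ccontr)
  assume "(y, z) \<notin> S"
  then obtain U where U: "openin data_topology U" "(y, z) \<in> U"
    and miss: "\<forall>\<^sub>F h in sequentially. U \<inter> Ss h = {}"
    using kuratowski_limit_eventually_misses[OF K] by (metis UNIV_I topspace_data_topology)
  have "\<forall>\<^sub>F n in sequentially. (ys n, zs n) \<in> U"
    using data_lim_imp_limitin[OF lim] U by (simp add: limitin_def)
  moreover have "\<forall>\<^sub>F n in sequentially. U \<inter> Ss (r n) = {}"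
    using miss r by (rule eventually_subseq[rotated])
  ultimately have "\<forall>\<^sub>F n in sequentially. False"
    using mem by eventually_elim blast
  then show False
    by simp
qed

text \<open>The index \<open>k h\<close> is the largest \<open>j \<le> h\<close> for which \<open>P j\<close> is known to hold from \<open>h\<close> on. The
  bound \<open>j \<le> h\<close> keeps the set finite when all properties hold from the start.\<close>

lemma eventually_diagonal:
  assumes "\<And>k. \<forall>\<^sub>F h in sequentially. P k h"
  obtains k :: "nat \<Rightarrow> nat"
    where "filterlim k at_top sequentially" "\<forall>\<^sub>F h in sequentially. P (k h) h"
proof -
  obtain N where N: "\<And>k h. h \<ge> N k \<Longrightarrow> P k h"
    using assms unfolding eventually_sequentially by metis
  define k where "k h = Max {j. j \<le> h \<and> N j \<le> h}" for h
  have fin: "finite {j. j \<le> h \<and> N j \<le> h}" for h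
    by simp
  have "k h \<ge> j" if "h \<ge> max j (N j)" for j h
    unfolding k_def using that by (intro Max_ge[OF fin]) auto
  then have "filterlim k at_top sequentially"
    unfolding filterlim_at_top eventually_sequentially by blast
  moreover have "P (k h) h" if "h \<ge> N 0" for h
  proof (rule N)
    have "{j. j \<le> h \<and> N j \<le> h} \<noteq> {}"
      using that by blast
    from Max_in[OF fin this] show "N (k h) \<le> h"
      by (simp add: k_def)
  qed
  then have "\<forall>\<^sub>F h in sequentially. P (k h) h"
    unfolding eventually_sequentially by blast
  ultimately show ?thesis
    by (rule that)
qed

text \<open>The sets \<open>W k\<close> need not be a neighbourhood base at \<open>z\<close>; on a bounded set they serve as one
  when the \<open>f i\<close> have dense span.\<close>

lemma functional_neighbourhood_sequence:
  fixes f :: "nat \<Rightarrow> 'a::real_normed_vector \<Rightarrow>\<^sub>L real" and z :: 'a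
  defines "W \<equiv> \<lambda>k. \<Inter>i<k. {x. \<bar>blinfun_apply (f i) x - blinfun_apply (f i) z\<bar> < 1 / Suc k}"
  shows "openin weak_topology (W k)" and "z \<in> W k"
    and "filterlim k' at_top F \<Longrightarrow> \<forall>\<^sub>F h in F. x h \<in> W (k' h) \<Longrightarrow>
      ((\<lambda>h. blinfun_apply (f i) (x h)) \<longlongrightarrow> blinfun_apply (f i) z) F"
proof -
  have "openin weak_topology {x. \<bar>blinfun_apply g x - blinfun_apply g z\<bar> < e}"
    for g :: "'a \<Rightarrow>\<^sub>L real" and e
  proof -
    have "{x. \<bar>blinfun_apply g x - blinfun_apply g z\<bar> < e} = blinfun_apply g -` ball (blinfun_apply g z) e"
      by (auto simp: dist_real_def abs_minus_commute)
    then show ?thesis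
      unfolding weak_topology_def by (intro topology_generated_by_Basis) blast
  qed
  then have "openin weak_topology (W k \<inter> topspace weak_topology)"
    unfolding W_def by (intro openin_INT) auto
  then show "openin weak_topology (W k)"
    by simp
  show "z \<in> W k"
    by (simp add: W_def)
  assume k': "filterlim k' at_top F" and x: "\<forall>\<^sub>F h in F. x h \<in> W (k' h)"
  have null: "((\<lambda>h. 1 / real (Suc (k' h))) \<longlongrightarrow> 0) F"
    using filterlim_compose[OF LIMSEQ_Suc[OF lim_1_over_n] k'] by simp
  have bound: "\<forall>\<^sub>F h in F. norm (blinfun_apply (f i) (x h) - blinfun_apply (f i) z) \<le> 1 / real (Suc (k' h))"
    using x eventually_compose_filterlim[OF eventually_gt_at_top[of i] k']
    by eventually_elim (auto simp: W_def intro: less_imp_le)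
  show "((\<lambda>h. blinfun_apply (f i) (x h)) \<longlongrightarrow> blinfun_apply (f i) z) F"
    by (rule LIM_zero_cancel[OF Lim_null_comparison[OF bound null]])
qed

lemma data_functional_eq:
  "y \<in> D \<Longrightarrow> z \<in> E \<Longrightarrow> data_functional D E y z = ereal ((norm (y - z))\<^sup>2)"
  by (simp add: data_functional_def inf_indicator_def)

lemma data_functional_finite_imp:
  "data_functional D E y z < \<infinity> \<Longrightarrow> y \<in> D \<and> z \<in> E"
  by (auto simp: data_functional_def inf_indicator_def split: if_splits)

lemma data_functional_tendsto_zero_iff:
  "((\<lambda>h. data_functional (Dh h) E (ys h) (zs h)) \<longlongrightarrow> 0) F \<longleftrightarrow>
     (\<forall>\<^sub>F h in F. ys h \<in> Dh h \<and> zs h \<in> E) \<and> ((\<lambda>h. ys h - zs h) \<longlongrightarrow> 0) F" (is "?L \<longleftrightarrow> ?M \<and> ?N")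
proof -
  have "?L \<longleftrightarrow> ?N" if ?M
  proof -
    have "?L \<longleftrightarrow> ((\<lambda>h. ereal ((norm (ys h - zs h))\<^sup>2)) \<longlongrightarrow> ereal 0) F"
      unfolding zero_ereal_def
      by (intro tendsto_cong eventually_mono[OF \<open>?M\<close>]) (simp add: data_functional_eq)
    also have "\<dots> \<longleftrightarrow> ((\<lambda>h. (norm (ys h - zs h))\<^sup>2) \<longlongrightarrow> 0) F"
      by simp
    also have "\<dots> \<longleftrightarrow> ?N"
      using tendsto_real_sqrt[of "\<lambda>h. (norm (ys h - zs h))\<^sup>2" 0 F]
        tendsto_power[of "\<lambda>h. norm (ys h - zs h)" 0 F 2]
      by (auto intro: tendsto_norm_zero_cancel dest: tendsto_norm_zero)
    finally show ?thesis .
  qed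
  moreover have ?M if ?L
  proof -
    have "\<forall>\<^sub>F h in F. data_functional (Dh h) E (ys h) (zs h) < \<infinity>"
      using order_tendstoD(2)[OF that, of \<infinity>] by simp
    then show ?thesis
      by eventually_elim (rule data_functional_finite_imp)
  qed
  ultimately show ?thesis
    by blast
qed

lemma transversality_bound:
  fixes y z :: "'a::real_normed_vector"
  assumes "c > 0" "norm (y - z) \<ge> c * (norm y + norm z) - b" "norm (y - z) \<le> 1"
  shows "norm z \<le> (1 + b) / c"
proof -
  have "norm y + norm z \<le> (1 + b) / c"
    using assms by (simp add: field_simps)
  then show ?thesis
    using norm_ge_zero[of y] by linarith
qed

lemma data_lim_diagonalI:
  fixes ys zs :: "nat \<Rightarrow> 'a::real_normed_vector"
  assumes "limitin weak_topology zs z sequentially" "(\<lambda>h. ys h - zs h) \<longlonglongrightarrow> 0"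
  shows "data_lim ys zs z z"
proof -
  have "(\<lambda>h. blinfun_apply f (ys h)) \<longlonglongrightarrow> blinfun_apply f z" for f :: "'a \<Rightarrow>\<^sub>L real"
  proof -
    have "(\<lambda>h. blinfun_apply f (ys h - zs h) + blinfun_apply f (zs h)) \<longlonglongrightarrow>
        blinfun_apply f 0 + blinfun_apply f z"
    proof (rule tendsto_add)
      show "(\<lambda>h. blinfun_apply f (zs h)) \<longlonglongrightarrow> blinfun_apply f z"
        using assms(1) by (simp add: limitin_weak_topology_iff)
    qed (intro blinfun.tendsto tendsto_const assms(2))
    then show ?thesis
      by (simp add: blinfun.diff_right)
  qed
  with assms show ?thesis
    by (simp add: data_lim_def limitin_weak_topology_iff)
qed

section \<open>Compactness and recovery of data sequences\<close>

text \<open>Only the \<open>zs\<close> are extracted by weak compactness; the \<open>ys\<close> follow because the differences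
  tend to zero in norm.\<close>

theorem data_sequence_compactness:
  fixes D E :: "'a::real_normed_vector set" and Dh :: "nat \<Rightarrow> 'a set"
  assumes reflexive: "reflexive_space TYPE('a)"
    and separable: "separable_space (euclidean :: 'a topology)"
    and K: "kuratowski_limit data_topology (\<lambda>h. Dh h \<times> E) (D \<times> E)"
    and c: "c > 0"
    and trans: "\<forall>h. \<forall>y \<in> Dh h. \<forall>z \<in> E. norm (y - z) \<ge> c * (norm y + norm z) - b"
    and lim: "(\<lambda>h. data_functional (Dh h) E (ys h) (zs h)) \<longlonglongrightarrow> 0"
  obtains z r where "z \<in> D \<inter> E" "strict_mono (r :: nat \<Rightarrow> nat)" "data_lim (ys \<circ> r) (zs \<circ> r) z z"
proof -
  have mem: "\<forall>\<^sub>F h in sequentially. ys h \<in> Dh h \<and> zs h \<in> E"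
    and diff: "(\<lambda>h. ys h - zs h) \<longlonglongrightarrow> 0"
    using lim by (simp_all add: data_functional_tendsto_zero_iff)
  have "\<forall>\<^sub>F h in sequentially. norm (ys h - zs h) < 1"
    using tendstoD[OF diff, of 1] by simp
  with mem have "\<forall>\<^sub>F h in sequentially. ys h \<in> Dh h \<and> zs h \<in> E \<and> norm (zs h) \<le> (1 + b) / c"
    by eventually_elim (use transversality_bound[OF c] trans in \<open>blast intro: less_imp_le\<close>)
  then obtain N where N: "\<And>h. h \<ge> N \<Longrightarrow> ys h \<in> Dh h \<and> zs h \<in> E \<and> norm (zs h) \<le> (1 + b) / c"
    unfolding eventually_sequentially by blast
  obtain z s where s: "strict_mono (s :: nat \<Rightarrow> nat)"
    and z: "limitin weak_topology ((\<lambda>n. zs (n + N)) \<circ> s) z sequentially"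
    using bounded_weakly_convergent_subsequence[OF reflexive separable, of "\<lambda>n. zs (n + N)"] N
    by (metis le_add2)
  \<comment> \<open>The tail is shifted by \<open>N\<close> because the points are constrained and bounded only from there on.\<close>
  define r where "r n = s n + N" for n
  have r: "strict_mono r"
    using s by (simp add: r_def strict_mono_def)
  have dl: "data_lim (ys \<circ> r) (zs \<circ> r) z z"
  proof (rule data_lim_diagonalI)
    show "limitin weak_topology (zs \<circ> r) z sequentially"
      using z by (simp add: r_def comp_def)
    show "(\<lambda>h. (ys \<circ> r) h - (zs \<circ> r) h) \<longlonglongrightarrow> 0"
      using LIMSEQ_subseq_LIMSEQ[OF diff r] by (simp add: comp_def)
  qed
  have "(z, z) \<in> D \<times> E"
    by (rule kuratowski_limit_data_lim_mem[OF K r dl]) (use N in \<open>simp add: r_def\<close>)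
  with r dl that show ?thesis
    by blast
qed

text \<open>Choosing points in the shrinking neighbourhoods \<open>U k\<close> makes the differences tend to zero
  and gives convergence along countably many functionals; the bound from transversality
  upgrades the latter to weak convergence.\<close>

theorem data_sequence_recovery:
  fixes D E :: "'a::real_normed_vector set" and Dh :: "nat \<Rightarrow> 'a set"
  assumes reflexive: "reflexive_space TYPE('a)"
    and separable: "separable_space (euclidean :: 'a topology)"
    and K: "kuratowski_limit data_topology (\<lambda>h. Dh h \<times> E) (D \<times> E)"
    and c: "c > 0"
    and trans: "\<forall>h. \<forall>y \<in> Dh h. \<forall>z \<in> E. norm (y - z) \<ge> c * (norm y + norm z) - b"
    and z: "z \<in> D \<inter> E"
  obtains ys zs where "data_lim ys zs z z"
    "(\<lambda>h. data_functional (Dh h) E (ys h) (zs h)) \<longlonglongrightarrow> 0"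
proof -
  obtain G :: "('a \<Rightarrow>\<^sub>L real) set" where G: "countable G" "G \<noteq> {}" "closure (span G) = UNIV"
    using reflexive_separable_dual_dense_span[OF reflexive separable] by metis
  define f where "f = from_nat_into G"
  have f: "range f = G"
    using G by (simp add: f_def range_from_nat_into)
  define W where "W k = (\<Inter>i<k. {x. \<bar>blinfun_apply (f i) x - blinfun_apply (f i) z\<bar> < 1 / Suc k})" for k
  define U where "U k = (W k \<times> W k) \<inter> {(y, w). y - w \<in> ball 0 (1 / Suc k)}" for k
  note W = functional_neighbourhood_sequence[where f = f and z = z, folded W_def]
  have "\<forall>\<^sub>F h in sequentially. U k \<inter> (Dh h \<times> E) \<noteq> {}" for k
  proof (rule kuratowski_limit_eventually_meets[OF K])
    show "(z, z) \<in> D \<times> E"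
      using z by blast
    show "(z, z) \<in> U k"
      using W(2) by (simp add: U_def)
    show "openin data_topology (U k)"
      unfolding U_def by (intro openin_data_topology_Basis W(1) open_ball)
  qed
  then obtain k where k: "filterlim k at_top sequentially"
    and meets: "\<forall>\<^sub>F h in sequentially. U (k h) \<inter> (Dh h \<times> E) \<noteq> {}"
    using eventually_diagonal[of "\<lambda>k h. U k \<inter> (Dh h \<times> E) \<noteq> {}"] by blast
  \<comment> \<open>For the finitely many \<open>h\<close> at which the intersection may be empty, the choice is arbitrary.\<close>
  define p where "p h = (SOME p. p \<in> U (k h) \<inter> (Dh h \<times> E))" for h
  define ys zs where "ys h = fst (p h)" and "zs h = snd (p h)" for h
  from meets have "\<forall>\<^sub>F h in sequentially. p h \<in> U (k h) \<inter> (Dh h \<times> E)"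
    by eventually_elim (unfold p_def, rule some_in_eq[THEN iffD2])
  then have mem: "\<forall>\<^sub>F h in sequentially. ys h \<in> Dh h \<and> zs h \<in> E"
    and zW: "\<forall>\<^sub>F h in sequentially. zs h \<in> W (k h)"
    and close: "\<forall>\<^sub>F h in sequentially. norm (ys h - zs h) \<le> 1 / real (Suc (k h))"
    by (auto elim!: eventually_mono simp: U_def ys_def zs_def)
  have "(\<lambda>h. 1 / real (Suc (k h))) \<longlonglongrightarrow> 0"
    using filterlim_compose[OF LIMSEQ_Suc[OF lim_1_over_n] k] by simp
  then have diff: "(\<lambda>h. ys h - zs h) \<longlonglongrightarrow> 0"
    by (rule Lim_null_comparison[OF close])
  have "limitin weak_topology zs z sequentially"
  proof (rule limitin_weak_topology_dense_span[OF _ G(3)])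
    have "1 / real (Suc n) \<le> 1" for n
      by simp
    with close have "\<forall>\<^sub>F h in sequentially. norm (ys h - zs h) \<le> 1"
      by (auto elim!: eventually_mono intro: order_trans)
    with mem show "\<forall>\<^sub>F h in sequentially. norm (zs h) \<le> (1 + b) / c"
      by eventually_elim (use transversality_bound[OF c] trans in blast)
    show "(\<lambda>h. blinfun_apply g (zs h)) \<longlonglongrightarrow> blinfun_apply g z" if "g \<in> G" for g
      using W(3)[OF k zW] that f by blast
  qed
  with diff have "data_lim ys zs z z"
    by (intro data_lim_diagonalI)
  moreover have "(\<lambda>h. data_functional (Dh h) E (ys h) (zs h)) \<longlonglongrightarrow> 0"
    using mem diff by (simp add: data_functional_tendsto_zero_iff)
  ultimately show ?thesis
    by (rule that)
qed

theorem theorem3p2: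
  fixes D E :: "'z::banach set" and Dh :: "nat \<Rightarrow> 'z set"
  assumes reflexive: "reflexive_space TYPE('z)"
    and separable: "separable_space (euclidean :: 'z topology)"
    and E_closed: "weakly_seq_closed E"
    and data_convergence:
      "kuratowski_limit data_topology (\<lambda>h. Dh h \<times> E) (D \<times> E)"
    and equi_transversality:
      "\<exists>c b :: real. c > 0 \<and> b \<ge> 0 \<and>
         (\<forall>h. \<forall>y \<in> Dh h. \<forall>z \<in> E. norm (y - z) \<ge> c * (norm y + norm z) - b)"
  shows
    "(\<forall>ys zs. (\<lambda>h. data_functional (Dh h) E (ys h) (zs h)) \<longlonglongrightarrow> 0 \<longrightarrow>
        (\<exists>z \<in> D \<inter> E. \<exists>r :: nat \<Rightarrow> nat. strict_mono r \<and> data_lim (ys \<circ> r) (zs \<circ> r) z z)) \<and>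
     (\<forall>z \<in> D \<inter> E. \<exists>ys zs. data_lim ys zs z z \<and>
        (\<lambda>h. data_functional (Dh h) E (ys h) (zs h)) \<longlonglongrightarrow> 0)"
proof -
  obtain c b where c: "c > 0"
    and trans: "\<forall>h. \<forall>y \<in> Dh h. \<forall>z \<in> E. norm (y - z) \<ge> c * (norm y + norm z) - b"
    using equi_transversality by metis
  show ?thesis
  proof (intro conjI allI impI ballI)
    fix ys zs
    assume "(\<lambda>h. data_functional (Dh h) E (ys h) (zs h)) \<longlonglongrightarrow> 0"
    then obtain z r where "z \<in> D \<inter> E" "strict_mono (r :: nat \<Rightarrow> nat)" "data_lim (ys \<circ> r) (zs \<circ> r) z z"
      by (rule data_sequence_compactness[OF reflexive separable data_convergence c trans])
    then show "\<exists>z \<in> D \<inter> E. \<exists>r :: nat \<Rightarrow> nat. strict_mono r \<and> data_lim (ys \<circ> r) (zs \<circ> r) z z"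
      by blast
  next
    fix z
    assume "z \<in> D \<inter> E"
    then obtain ys zs where "data_lim ys zs z z"
        "(\<lambda>h. data_functional (Dh h) E (ys h) (zs h)) \<longlonglongrightarrow> 0"
      by (rule data_sequence_recovery[OF reflexive separable data_convergence c trans])
    then show "\<exists>ys zs. data_lim ys zs z z \<and> (\<lambda>h. data_functional (Dh h) E (ys h) (zs h)) \<longlonglongrightarrow> 0"
      by blast
  qed
qed

end
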